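(* Let $\mathfrak k\subseteq \mathrm{Vir}$ be a Lie subalgebra of finite codimension in the complex Virasoro algebra. Then there is $f\in\mathbb{C}[t,t^{-1}]\setminus\{0\}$ such that $\mathfrak k\supseteq \mathbb{C}z+f\,\mathbb{C}[t,t^{-1}]\partial_t$. In particular, any finite codimension subalgebra of $\mathrm{Vir}$ contains $z$.
   Context: $\mathrm{Vir}=\mathbb{C}[t,t^{-1}]\partial_t\oplus\mathbb{C}z$ is the Virasoro algebra, with $z$ central and $[f\partial_t,g\partial_t]=(fg'-f'g)\partial_t+\mathrm{Res}_0(f'g''-g'f'')z$, where $\mathrm{Res}_0$ denotes the coefficient of $t^{-1}$. *)

theory Defs
  imports "HOL-Library.Poly_Mapping" "HOL-Library.Product_Plus" Complex_Main
begin

locale lie_algebra = vector_space scale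
  for scale :: "'a::field \<Rightarrow> 'b::ab_group_add \<Rightarrow> 'b" +
  fixes bracket :: "'b \<Rightarrow> 'b \<Rightarrow> 'b"
  assumes bracket_add_left: "bracket (x + y) w = bracket x w + bracket y w"
    and bracket_add_right: "bracket w (x + y) = bracket w x + bracket w y"
    and bracket_scale_left: "bracket (scale c x) y = scale c (bracket x y)"
    and bracket_scale_right: "bracket x (scale c y) = scale c (bracket x y)"
    and bracket_self: "bracket x x = 0"
    and jacobi: "bracket x (bracket y w) + bracket y (bracket w x) + bracket w (bracket x y) = 0"
begin

definition lie_subalgebra :: "'b set \<Rightarrow> bool" where
  "lie_subalgebra S \<longleftrightarrow> subspace S \<and> (\<forall>x\<in>S. \<forall>y\<in>S. bracket x y \<in> S)"

text \<open>The quotient by \<open>S\<close> is spanned by finitely many cosets, namely those of the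
  elements of \<open>B\<close>; the quotient space itself is not constructed.\<close>

definition finite_codimension :: "'b set \<Rightarrow> bool" where
  "finite_codimension S \<longleftrightarrow>
     subspace S \<and> (\<exists>B. finite B \<and> (\<forall>v. \<exists>w\<in>span B. v - w \<in> S))"

end


text \<open>The Laurent polynomial ring is the group ring of the integers: the finitely supported
  function \<open>f\<close> stands for the sum of the terms \<open>Poly_Mapping.lookup f n * t^n\<close>,
  and the product of \<^theory>\<open>HOL-Library.Poly_Mapping\<close> is convolution.\<close>

type_synonym laurent = "int \<Rightarrow>\<^sub>0 complex"

definition laurent_scale :: "complex \<Rightarrow> laurent \<Rightarrow> laurent" where
  "laurent_scale c f = Poly_Mapping.map ((*) c) f"

lift_definition laurent_deriv :: "laurent \<Rightarrow> laurent"
  is "\<lambda>f n. of_int (n + 1) * f (n + 1)"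
proof -
  fix f :: "int \<Rightarrow> complex"
  assume "finite {n. f n \<noteq> 0}"
  then have "finite ((\<lambda>n. n - 1) ` {n. f n \<noteq> 0})"
    by simp
  moreover have "{n. of_int (n + 1) * f (n + 1) \<noteq> 0} \<subseteq> (\<lambda>n. n - 1) ` {n. f n \<noteq> 0}"
    by (force intro: rev_image_eqI)
  ultimately show "finite {n. of_int (n + 1) * f (n + 1) \<noteq> 0}"
    by (rule rev_finite_subset)
qed

definition laurent_res :: "laurent \<Rightarrow> complex" where
  "laurent_res f = Poly_Mapping.lookup f (-1)"

text \<open>The pair \<open>(f, a)\<close> stands for the element f d/dt + a z.\<close>

type_synonym virasoro = "laurent \<times> complex"

definition vir_vf :: "laurent \<Rightarrow> virasoro" where
  "vir_vf f = (f, 0)"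

definition vir_z :: virasoro where
  "vir_z = (0, 1)"

definition vir_scale :: "complex \<Rightarrow> virasoro \<Rightarrow> virasoro" where
  "vir_scale c x = (laurent_scale c (fst x), c * snd x)"

definition vir_bracket :: "virasoro \<Rightarrow> virasoro \<Rightarrow> virasoro" where
  "vir_bracket x y =
     (let f = fst x; g = fst y; D = laurent_deriv
      in (f * D g - D f * g, laurent_res (D f * D (D g) - D g * D (D f))))"

lemma laurent_scale_conv_mult: "laurent_scale c f = Poly_Mapping.single 0 c * f"
  by (simp add: laurent_scale_def mult_map_scale_conv_mult)

lemma lookup_laurent_scale [simp]: "Poly_Mapping.lookup (laurent_scale c f) n = c * Poly_Mapping.lookup f n"
  by (simp add: laurent_scale_def map.rep_eq when_def)

lemma lookup_laurent_deriv:
  "Poly_Mapping.lookup (laurent_deriv f) n = of_int (n + 1) * Poly_Mapping.lookup f (n + 1)"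
  by (simp add: laurent_deriv.rep_eq)

lemma laurent_deriv_add: "laurent_deriv (f + g) = laurent_deriv f + laurent_deriv g"
  by (rule poly_mapping_eqI) (simp add: lookup_laurent_deriv lookup_add algebra_simps)

lemma laurent_deriv_diff: "laurent_deriv (f - g) = laurent_deriv f - laurent_deriv g"
  by (rule poly_mapping_eqI) (simp add: lookup_laurent_deriv lookup_minus algebra_simps)

lemma laurent_deriv_scale: "laurent_deriv (laurent_scale c f) = laurent_scale c (laurent_deriv f)"
  by (rule poly_mapping_eqI) (simp add: lookup_laurent_deriv)

lemma laurent_deriv_zero [simp]: "laurent_deriv 0 = 0"
  by (rule poly_mapping_eqI) (simp add: lookup_laurent_deriv)

lemma laurent_deriv_single:
  "laurent_deriv (Poly_Mapping.single k a) = Poly_Mapping.single (k - 1) (of_int k * a)"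
  by (rule poly_mapping_eqI) (auto simp: lookup_laurent_deriv lookup_single when_def)

lemma laurent_induct [case_names zero add_single]:
  fixes f :: laurent
  assumes "P 0" and "\<And>f k a. P f \<Longrightarrow> P (f + Poly_Mapping.single k a)"
  shows "P f"
proof (induction f rule: update_induct)
  case const
  show ?case by (fact assms(1))
next
  case (update f a b)
  have "Poly_Mapping.update a b f = f + Poly_Mapping.single a b"
    using update.hyps(1)
    by (intro poly_mapping_eqI) (auto simp: lookup_update lookup_add lookup_single when_def in_keys_iff)
  then show ?case
    using assms(2) update.IH by simp
qed

lemma laurent_deriv_mult:
  "laurent_deriv (f * g) = laurent_deriv f * g + f * laurent_deriv g"
proof (induction f rule: laurent_induct)
  case zero
  show ?case by simp
next
  case (add_single f k a)
  have "laurent_deriv (Poly_Mapping.single k a * g) =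
        laurent_deriv (Poly_Mapping.single k a) * g + Poly_Mapping.single k a * laurent_deriv g"
  proof (induction g rule: laurent_induct)
    case zero
    show ?case by simp
  next
    case (add_single g l b)
    then show ?case
      by (simp add: laurent_deriv_add laurent_deriv_single mult_single single_add [symmetric]
          algebra_simps)
  qed
  with add_single show ?case
    by (simp add: laurent_deriv_add algebra_simps)
qed

lemma laurent_res_deriv [simp]: "laurent_res (laurent_deriv f) = 0"
  by (simp add: laurent_res_def lookup_laurent_deriv)

lemma laurent_res_add: "laurent_res (f + g) = laurent_res f + laurent_res g"
  by (simp add: laurent_res_def lookup_add)

lemma laurent_res_scale: "laurent_res (laurent_scale c f) = c * laurent_res f"
  by (simp add: laurent_res_def)

global_interpretation Vir: lie_algebra vir_scale vir_bracket
proof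
  fix a b :: complex and x y w :: virasoro
  let ?D = laurent_deriv
  show "vir_scale a (x + y) = vir_scale a x + vir_scale a y"
    by (simp add: vir_scale_def laurent_scale_conv_mult algebra_simps)
  show "vir_scale (a + b) x = vir_scale a x + vir_scale b x"
    by (simp add: vir_scale_def laurent_scale_conv_mult single_add algebra_simps)
  show "vir_scale a (vir_scale b x) = vir_scale (a * b) x"
    by (simp add: vir_scale_def laurent_scale_conv_mult mult_single mult.assoc [symmetric])
  show "vir_scale 1 x = x"
    by (simp add: vir_scale_def laurent_scale_conv_mult)
  show "vir_bracket (x + y) w = vir_bracket x w + vir_bracket y w"
    by (simp add: vir_bracket_def Let_def laurent_deriv_add laurent_res_add [symmetric]
        algebra_simps)
  show "vir_bracket w (x + y) = vir_bracket w x + vir_bracket w y"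
    by (simp add: vir_bracket_def Let_def laurent_deriv_add laurent_res_add [symmetric]
        algebra_simps)
  show "vir_bracket (vir_scale a x) y = vir_scale a (vir_bracket x y)"
    by (simp add: vir_bracket_def Let_def vir_scale_def laurent_deriv_scale
        laurent_res_scale [symmetric])
      (simp add: laurent_scale_conv_mult algebra_simps)
  show "vir_bracket x (vir_scale a y) = vir_scale a (vir_bracket x y)"
    by (simp add: vir_bracket_def Let_def vir_scale_def laurent_deriv_scale
        laurent_res_scale [symmetric])
      (simp add: laurent_scale_conv_mult algebra_simps)
  show "vir_bracket x x = 0"
    by (simp add: vir_bracket_def Let_def laurent_res_def zero_prod_def)
  show "vir_bracket x (vir_bracket y w) + vir_bracket y (vir_bracket w x)
          + vir_bracket w (vir_bracket x y) = 0"
  proof (rule prod_eqI)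
    show "fst (vir_bracket x (vir_bracket y w) + vir_bracket y (vir_bracket w x)
            + vir_bracket w (vir_bracket x y)) = fst 0"
      by (simp add: vir_bracket_def Let_def laurent_deriv_diff laurent_deriv_mult algebra_simps)
    have "snd (vir_bracket x (vir_bracket y w) + vir_bracket y (vir_bracket w x)
            + vir_bracket w (vir_bracket x y)) =
          laurent_res (?D (?D (?D (fst x)) * (?D (fst y) * fst w - fst y * ?D (fst w))
            + ?D (?D (fst y)) * (?D (fst w) * fst x - fst w * ?D (fst x))
            + ?D (?D (fst w)) * (?D (fst x) * fst y - fst x * ?D (fst y))))"
      by (simp add: vir_bracket_def Let_def laurent_deriv_diff laurent_deriv_add
          laurent_deriv_mult laurent_res_add [symmetric] del: laurent_res_deriv)
        (simp add: algebra_simps del: laurent_res_deriv)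
    then show "snd (vir_bracket x (vir_bracket y w) + vir_bracket y (vir_bracket w x)
            + vir_bracket w (vir_bracket x y)) = snd 0"
      by simp
  qed
qed

end

theory Submission
  imports Defs
begin

text \<open>
  Let \<open>\<kk>\<close> have finite codimension in the Virasoro algebra. Bracketing with \<open>x\<close> maps \<open>\<kk>\<close> to
  itself when \<open>x \<in> \<kk>\<close>, so the \<open>x \<in> \<kk>\<close> with \<open>[x, Vir] \<subseteq> \<kk>\<close> are cut out of \<open>\<kk>\<close> by the finitely
  many conditions \<open>[x, b] \<in> \<kk>\<close>, where \<open>b\<close> runs through representatives that span the quotient.
  Each condition costs finitely many dimensions, so some nonzero vector field \<open>f \<partial>\<close> satisfies
  all of them (lemma \<open>element_bracketing_all_into_subalgebra\<close>).

  Write \<open>F = f\<^sup>2\<close>. Since \<open>[f \<partial>, f g \<partial>] = F g' \<partial>\<close> modulo \<open>z\<close>, and every power of \<open>t\<close> except \<open>t\<^sup>-\<^sup>1\<close> is a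
  derivative, \<open>\<kk>\<close> contains \<open>F t\<^sup>a \<partial>\<close> modulo \<open>z\<close> for \<open>a \<noteq> -1\<close>. The bracket
  \<open>[F t\<^sup>a \<partial>, F t\<^sup>b \<partial>] = (b - a) F\<^sup>2 t\<^sup>a\<^sup>+\<^sup>b\<^sup>-\<^sup>1 \<partial>\<close> modulo \<open>z\<close> closes the gap: each integer is \<open>a + b - 1\<close>
  for distinct \<open>a, b \<noteq> -1\<close>, so \<open>\<kk>\<close> contains \<open>F\<^sup>2 t\<^sup>k \<partial>\<close> modulo \<open>z\<close> for every \<open>k\<close>.

  It remains to find \<open>z\<close> itself. The vector field \<open>F\<^sup>2 t\<^sup>k \<partial>\<close> arises from many pairs \<open>(a, b)\<close>, and
  their central terms differ. If \<open>F\<close> starts with \<open>c t\<^sup>d\<close>, take \<open>k = 1 - 2 d\<close>. Then the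
  residue sees only the lowest terms \<open>c t\<^sup>m\<close> and \<open>c t\<^sup>2\<^sup>-\<^sup>m\<close> of the two factors, and after
  division by \<open>b - a\<close> the central term is \<open>m (2 - m) c\<^sup>2\<close>. This depends on \<open>m\<close>, so the
  difference of two such elements is a nonzero multiple of \<open>z\<close>. Now \<open>F\<^sup>2\<close> generates the
  required ideal.
\<close>

section \<open>Lowest terms of Laurent polynomials\<close>

definition vanishes_below :: "int \<Rightarrow> laurent \<Rightarrow> bool" where
  "vanishes_below m f \<longleftrightarrow> (\<forall>k<m. Poly_Mapping.lookup f k = 0)"

lemma lookup_mult_laurent:
  fixes f g :: laurent
  shows "Poly_Mapping.lookup (f * g) k =
    Sum_any (\<lambda>i. Poly_Mapping.lookup f i * Poly_Mapping.lookup g (k - i))"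
proof -
  have "k = i + j \<longleftrightarrow> j = k - i" for i j
    by auto
  then show ?thesis
    by (simp add: lookup_mult)
qed

lemma vanishes_below_mult:
  assumes "vanishes_below m f" and "vanishes_below n g"
  shows "vanishes_below (m + n) (f * g)"
  unfolding vanishes_below_def
proof (intro allI impI)
  fix k assume "k < m + n"
  have "Poly_Mapping.lookup f i * Poly_Mapping.lookup g (k - i) = 0" for i
    using assms \<open>k < m + n\<close> unfolding vanishes_below_def by (cases "i < m") auto
  then show "Poly_Mapping.lookup (f * g) k = 0"
    by (simp add: lookup_mult_laurent del: mult_eq_0_iff)
qed

lemma lookup_mult_lowest:
  assumes "vanishes_below m f" and "vanishes_below n g"
  shows "Poly_Mapping.lookup (f * g) (m + n) = Poly_Mapping.lookup f m * Poly_Mapping.lookup g n"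
proof -
  have "Poly_Mapping.lookup f i * Poly_Mapping.lookup g (m + n - i) =
      (Poly_Mapping.lookup f m * Poly_Mapping.lookup g n when i = m)" for i
    using assms unfolding vanishes_below_def by (cases i m rule: linorder_cases) auto
  then show ?thesis
    by (simp only: lookup_mult_laurent Sum_any_when_equal)
qed

lemma vanishes_below_deriv:
  "vanishes_below m f \<Longrightarrow> vanishes_below (m - 1) (laurent_deriv f)"
  by (simp add: vanishes_below_def lookup_laurent_deriv)

lemma lowest_term_exists:
  assumes "f \<noteq> 0"
  obtains m where "vanishes_below m f" and "Poly_Mapping.lookup f m \<noteq> 0"
proof
  have "Poly_Mapping.keys f \<noteq> {}"
    using assms by simp
  then have "Min (Poly_Mapping.keys f) \<in> Poly_Mapping.keys f"
    by (intro Min_in) auto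
  then show "Poly_Mapping.lookup f (Min (Poly_Mapping.keys f)) \<noteq> 0"
    by (simp add: in_keys_iff)
  show "vanishes_below (Min (Poly_Mapping.keys f)) f"
    unfolding vanishes_below_def
    by (metis Min_le finite_keys in_keys_iff not_less)
qed

text \<open>
  The cocycle lowers the total degree by 3, so for orders with \<open>m + n = 2\<close> the coefficient of
  \<open>t\<^sup>-\<^sup>1\<close> is the lowest one and only the lowest terms of \<open>f\<close> and \<open>g\<close> contribute to it.
\<close>

lemma cocycle_lowest:
  assumes f: "vanishes_below m f" and g: "vanishes_below n g" and "m + n = 2"
  shows "snd (vir_bracket (f, a) (g, b)) =
    of_int (m * n * (n - m)) * (Poly_Mapping.lookup f m * Poly_Mapping.lookup g n)"
proof -
  let ?D = laurent_deriv
  have idx: "(m - 1) + (n - 1 - 1) = -1" "(n - 1) + (m - 1 - 1) = -1"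
    using \<open>m + n = 2\<close> by auto
  note Df = vanishes_below_deriv[OF f] and Dg = vanishes_below_deriv[OF g]
  have "snd (vir_bracket (f, a) (g, b)) =
      Poly_Mapping.lookup (?D f) (m - 1) * Poly_Mapping.lookup (?D (?D g)) (n - 1 - 1)
      - Poly_Mapping.lookup (?D g) (n - 1) * Poly_Mapping.lookup (?D (?D f)) (m - 1 - 1)"
    by (simp add: vir_bracket_def Let_def laurent_res_def lookup_minus
        lookup_mult_lowest[OF Df vanishes_below_deriv[OF Dg], unfolded idx]
        lookup_mult_lowest[OF Dg vanishes_below_deriv[OF Df], unfolded idx])
  then show ?thesis
    by (simp add: lookup_laurent_deriv algebra_simps)
qed

section \<open>Vector fields that bracket the whole algebra into a subalgebra\<close>

text \<open>
  This is a form of infinite dimensionality that is convenient for elimination: a vector field of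
  order above a nonzero term of \<open>f\<close> cannot cancel that term of \<open>f\<close>.
\<close>

definition has_elements_of_high_order :: "virasoro set \<Rightarrow> bool" where
  "has_elements_of_high_order U \<longleftrightarrow>
    (\<forall>M. \<exists>f. f \<noteq> 0 \<and> vanishes_below M f \<and> vir_vf f \<in> U)"

lemma vir_vf_diff_scale:
  "vir_vf (laurent_scale a f - laurent_scale b g) = vir_scale a (vir_vf f) - vir_scale b (vir_vf g)"
  by (simp add: vir_vf_def vir_scale_def)

text \<open>
  The condition \<open>T x \<in> S\<close> costs at most one dimension for each element of \<open>B\<close>. Enlarging \<open>S\<close> by
  the line through one \<open>b \<in> B\<close> leaves one representative fewer; two solutions for the larger
  subspace then combine to a solution for \<open>S\<close>.
\<close>

lemma high_order_preimage:
  assumes "finite B" and "Vir.subspace S" and "\<forall>v. \<exists>w\<in>Vir.span B. v - w \<in> S"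
    and "Vir.subspace U" and "has_elements_of_high_order U"
    and T: "Vector_Spaces.linear vir_scale vir_scale T"
  shows "has_elements_of_high_order {x \<in> U. T x \<in> S}"
  using assms(1-3)
proof (induction B arbitrary: S)
  case empty
  then have "S = UNIV"
    by (auto simp: Vir.span_empty)
  with assms(5) show ?case by simp
next
  case (insert b B)
  interpret T: Vector_Spaces.linear vir_scale vir_scale T by (fact T)
  define S' where "S' = {y. \<exists>c. y - vir_scale c b \<in> S}"
  note S = \<open>Vir.subspace S\<close>
  have "Vir.subspace S'"
  proof (rule Vir.subspaceI)
    show "0 \<in> S'"
      unfolding S'_def using Vir.subspace_0[OF S] by (auto intro!: exI[of _ 0])
  next
    fix x y assume "x \<in> S'" "y \<in> S'"
    then obtain c d where "x - vir_scale c b \<in> S" "y - vir_scale d b \<in> S"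
      unfolding S'_def by auto
    from Vir.subspace_add[OF S this] show "x + y \<in> S'"
      unfolding S'_def by (auto intro!: exI[of _ "c + d"] simp: Vir.scale_left_distrib algebra_simps)
  next
    fix a x assume "x \<in> S'"
    then obtain c where "x - vir_scale c b \<in> S"
      unfolding S'_def by auto
    from Vir.subspace_scale[OF S this, of a] show "vir_scale a x \<in> S'"
      unfolding S'_def by (auto intro!: exI[of _ "a * c"] simp: Vir.scale_right_diff_distrib)
  qed
  moreover have "\<forall>v. \<exists>w\<in>Vir.span B. v - w \<in> S'"
  proof
    fix v
    obtain w where w: "w \<in> Vir.span (insert b B)" "v - w \<in> S"
      using insert.prems by blast
    then obtain c where "w - vir_scale c b \<in> Vir.span B"
      by (auto simp: Vir.span_insert)
    moreover have "v - (w - vir_scale c b) \<in> S'"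
      unfolding S'_def using w by (auto intro!: exI[of _ c])
    ultimately show "\<exists>w\<in>Vir.span B. v - w \<in> S'" by blast
  qed
  ultimately have IH: "has_elements_of_high_order {x \<in> U. T x \<in> S'}"
    by (rule insert.IH)
  show ?case
    unfolding has_elements_of_high_order_def
  proof
    fix M
    obtain f where f: "f \<noteq> 0" "vanishes_below M f" "vir_vf f \<in> U" "T (vir_vf f) \<in> S'"
      using IH unfolding has_elements_of_high_order_def by blast
    then obtain n where n: "Poly_Mapping.lookup f n \<noteq> 0"
      by (meson lowest_term_exists)
    \<comment> \<open>Order above \<open>n\<close> ensures that no multiple of \<open>g\<close> cancels the term of \<open>f\<close> in degree \<open>n\<close>.\<close>
    obtain g where g: "g \<noteq> 0" "vanishes_below (max M (n + 1)) g" "vir_vf g \<in> U" "T (vir_vf g) \<in> S'"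
      using IH unfolding has_elements_of_high_order_def by blast
    from f g obtain c d where c: "T (vir_vf f) - vir_scale c b \<in> S"
      and d: "T (vir_vf g) - vir_scale d b \<in> S"
      unfolding S'_def by auto
    show "\<exists>h. h \<noteq> 0 \<and> vanishes_below M h \<and> vir_vf h \<in> {x \<in> U. T x \<in> S}"
    proof (cases "d = 0")
      case True
      with d g show ?thesis
        by (intro exI[of _ g]) (auto simp: vanishes_below_def)
    next
      case False
      define h where "h = laurent_scale d f - laurent_scale c g"
      have "Poly_Mapping.lookup h n = d * Poly_Mapping.lookup f n"
        using g(2) by (simp add: h_def lookup_minus vanishes_below_def)
      then have "h \<noteq> 0"
        using False n by auto
      moreover have "vanishes_below M h"
        using f(2) g(2) by (simp add: h_def lookup_minus vanishes_below_def)
      moreover have "vir_vf h \<in> U"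
        unfolding h_def vir_vf_diff_scale
        by (intro Vir.subspace_diff Vir.subspace_scale f g assms(4))
      moreover have "T (vir_vf h) = vir_scale d (T (vir_vf f) - vir_scale c b)
          - vir_scale c (T (vir_vf g) - vir_scale d b)"
        unfolding h_def vir_vf_diff_scale T.diff T.scale
        by (simp add: Vir.scale_right_diff_distrib mult.commute)
      then have "T (vir_vf h) \<in> S"
        using c d by (auto intro!: Vir.subspace_diff Vir.subspace_scale S)
      ultimately show ?thesis by blast
    qed
  qed
qed

lemma linear_bracket: "Vector_Spaces.linear vir_scale vir_scale (\<lambda>x. vir_bracket x b)"
  by unfold_locales (simp_all add: Vir.bracket_add_left Vir.bracket_scale_left)

lemma linear_ident: "Vector_Spaces.linear vir_scale vir_scale (\<lambda>x. x)"
  by unfold_locales simp_all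

text \<open>
  An element \<open>x \<in> K\<close> already brackets \<open>K\<close> into \<open>K\<close>, so \<open>[x, b] \<in> K\<close> need only be imposed for the
  finitely many \<open>b\<close> that span the quotient, one after the other.
\<close>

lemma element_bracketing_all_into_subalgebra:
  assumes "Vir.lie_subalgebra K" and "Vir.finite_codimension K"
  obtains f where "f \<noteq> 0" and "\<And>y. vir_bracket (vir_vf f) y \<in> K"
proof -
  from assms obtain B where K: "Vir.subspace K" and B: "finite B" "\<forall>v. \<exists>w\<in>Vir.span B. v - w \<in> K"
    unfolding Vir.finite_codimension_def by blast
  have subalg: "vir_bracket x y \<in> K" if "x \<in> K" "y \<in> K" for x y
    using assms(1) that unfolding Vir.lie_subalgebra_def by blast
  define U where "U = (\<lambda>C. {x \<in> K. \<forall>b\<in>C. vir_bracket x b \<in> K})"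
  have subspace_U: "Vir.subspace (U C)" for C
    unfolding U_def Vir.subspace_def
    using K Vir.bracket_scale_left[of 0]
    by (auto simp: Vir.bracket_add_left Vir.bracket_scale_left Vir.subspace_def)
  have "finite C \<Longrightarrow> has_elements_of_high_order (U C)" for C
  proof (induction C rule: finite_induct)
    case empty
    have "has_elements_of_high_order UNIV"
      unfolding has_elements_of_high_order_def
    proof
      fix M
      show "\<exists>f. f \<noteq> 0 \<and> vanishes_below M f \<and> vir_vf f \<in> UNIV"
        by (intro exI[of _ "Poly_Mapping.single M 1"])
          (auto simp: vanishes_below_def lookup_single when_def dest: arg_cong[of _ _ Poly_Mapping.keys])
    qed
    from high_order_preimage[OF B(1) K B(2) Vir.subspace_UNIV this linear_ident]
    show ?case by (simp add: U_def)
  next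
    case (insert b C)
    have "U (insert b C) = {x \<in> U C. vir_bracket x b \<in> K}"
      by (auto simp: U_def)
    with high_order_preimage[OF B(1) K B(2) subspace_U insert.IH linear_bracket]
    show ?case by simp
  qed
  from this[OF B(1)] obtain f where f: "f \<noteq> 0" "vir_vf f \<in> U B"
    unfolding has_elements_of_high_order_def by blast
  have span: "vir_bracket (vir_vf f) w \<in> K" if "w \<in> Vir.span B" for w
    using that
  proof (rule Vir.span_induct)
    show "Vir.subspace {w. vir_bracket (vir_vf f) w \<in> K}"
      unfolding Vir.subspace_def
      using K Vir.bracket_scale_right[of _ 0]
      by (auto simp: Vir.bracket_add_right Vir.bracket_scale_right Vir.subspace_def)
  qed (use f in \<open>simp add: U_def\<close>)
  have "vir_bracket (vir_vf f) y \<in> K" for y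
  proof -
    obtain w where w: "w \<in> Vir.span B" "y - w \<in> K"
      using B(2) by blast
    have "vir_bracket (vir_vf f) w + vir_bracket (vir_vf f) (y - w) \<in> K"
      using f w by (intro Vir.subspace_add[OF K] span subalg) (auto simp: U_def)
    then show ?thesis
      by (simp flip: Vir.bracket_add_right)
  qed
  with f that show ?thesis by blast
qed

section \<open>The ideal and the centre\<close>

text \<open>The terms that contain \<open>f'\<close> cancel by antisymmetry.\<close>

lemma fst_bracket_mult:
  "fst (vir_bracket (f * u, a) (f * v, b)) =
    f * f * fst (vir_bracket (u, c) (v, d))"
  by (simp add: vir_bracket_def Let_def laurent_deriv_mult algebra_simps)

text \<open>
  Bracketing with \<open>f g\<close> rather than \<open>g\<close> cancels the term that contains \<open>f'\<close> and leaves \<open>f\<^sup>2 g'\<close>.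
  The exponent \<open>-1\<close> is excluded because \<open>t\<^sup>-\<^sup>1\<close> is not a derivative.
\<close>

lemma square_times_power_mem:
  assumes K: "Vir.subspace K" and f: "\<And>y. vir_bracket (vir_vf f) y \<in> K" and "a \<noteq> -1"
  obtains \<alpha> where "(f * f * Poly_Mapping.single a 1, \<alpha>) \<in> K"
proof -
  define g :: laurent where "g = Poly_Mapping.single (a + 1) (1 / of_int (a + 1))"
  have "(of_int (a + 1) :: complex) \<noteq> 0"
    using \<open>a \<noteq> -1\<close> unfolding of_int_eq_0_iff by presburger
  then have Dg: "laurent_deriv g = Poly_Mapping.single a 1"
    unfolding g_def laurent_deriv_single by simp
  have "fst (vir_bracket (vir_vf f) (vir_vf (f * g))) = f * f * Poly_Mapping.single a 1"
    by (simp add: vir_bracket_def vir_vf_def Let_def laurent_deriv_mult Dg algebra_simps)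
  then have "(f * f * Poly_Mapping.single a 1, snd (vir_bracket (vir_vf f) (vir_vf (f * g)))) \<in> K"
    using f[of "vir_vf (f * g)"] by (metis prod.collapse)
  with that show ?thesis .
qed

lemma fst_bracket_power:
  "fst (vir_bracket (Poly_Mapping.single a 1, \<alpha>) (Poly_Mapping.single b 1, \<beta>)) =
    Poly_Mapping.single (a + b - 1) (of_int (b - a))"
  by (simp add: vir_bracket_def Let_def laurent_deriv_single mult_single algebra_simps
      flip: single_diff)

theorem theorem1p2:
  fixes \<kk> :: "virasoro set"
  assumes "Vir.lie_subalgebra \<kk>"
    and "Vir.finite_codimension \<kk>"
  shows "(\<exists>f :: laurent. f \<noteq> 0 \<and>
            {vir_scale c vir_z + vir_vf (f * g) | c g. True} \<subseteq> \<kk>) \<and>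
         vir_z \<in> \<kk>"
proof -
  have K: "Vir.subspace \<kk>"
    and subalg: "\<And>x y. x \<in> \<kk> \<Longrightarrow> y \<in> \<kk> \<Longrightarrow> vir_bracket x y \<in> \<kk>"
    using assms(1) unfolding Vir.lie_subalgebra_def by auto
  obtain f where f: "f \<noteq> 0" "\<And>y. vir_bracket (vir_vf f) y \<in> \<kk>"
    using assms by (rule element_bracketing_all_into_subalgebra) blast
  define F where "F = f * f"
  let ?t = "\<lambda>a. Poly_Mapping.single a 1 :: laurent"
  obtain n where n: "vanishes_below n f" "Poly_Mapping.lookup f n \<noteq> 0"
    using f(1) by (rule lowest_term_exists)
  define d where "d = n + n"
  define c where "c = Poly_Mapping.lookup F d"
  have Fd: "vanishes_below d F" "c \<noteq> 0"
    using vanishes_below_mult[OF n(1) n(1)] lookup_mult_lowest[OF n(1) n(1)] n(2)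
    by (auto simp: F_def d_def c_def)
  have FF: "F * F \<noteq> 0"
    using lookup_mult_lowest[OF Fd(1) Fd(1)] Fd(2) by (auto simp: c_def)
  have product_mem: "(F * F * ?t (a + b - 1),
      snd (vir_bracket (F * ?t a, 0) (F * ?t b, 0)) / of_int (b - a)) \<in> \<kk>"
    if ab: "a \<noteq> -1" "b \<noteq> -1" "a \<noteq> b" for a b
  proof -
    obtain \<alpha> \<beta> where mem: "(F * ?t a, \<alpha>) \<in> \<kk>" "(F * ?t b, \<beta>) \<in> \<kk>"
      unfolding F_def using square_times_power_mem[OF K f(2)] ab(1,2) by metis
    have "vir_scale (1 / of_int (b - a)) (vir_bracket (F * ?t a, \<alpha>) (F * ?t b, \<beta>)) \<in> \<kk>"
      by (intro Vir.subspace_scale[OF K] subalg mem)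
    also have "vir_scale (1 / of_int (b - a)) (vir_bracket (F * ?t a, \<alpha>) (F * ?t b, \<beta>)) =
      (F * F * ?t (a + b - 1), snd (vir_bracket (F * ?t a, 0) (F * ?t b, 0)) / of_int (b - a))"
    proof (rule prod_eqI)
      have "(of_int (b - a) :: complex) \<noteq> 0"
        unfolding of_int_eq_0_iff using ab by simp
      then have "Poly_Mapping.single 0 (1 / of_int (b - a) :: complex) *
          (F * F * Poly_Mapping.single (a + b - 1) (of_int (b - a))) = F * F * ?t (a + b - 1)"
        by (simp add: mult.left_commute[of "Poly_Mapping.single 0 _"] mult_single del: of_int_diff)
      then show "fst (vir_scale (1 / of_int (b - a)) (vir_bracket (F * ?t a, \<alpha>) (F * ?t b, \<beta>))) =
          fst (F * F * ?t (a + b - 1), snd (vir_bracket (F * ?t a, 0) (F * ?t b, 0)) / of_int (b - a))"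
        by (simp add: vir_scale_def laurent_scale_conv_mult fst_bracket_mult[where c=0 and d=0]
            fst_bracket_power del: of_int_diff)
    qed (simp add: vir_scale_def vir_bracket_def Let_def)
    finally show ?thesis .
  qed
  \<comment> \<open>The bound on \<open>m\<close> keeps both exponents \<open>m - d\<close> and \<open>2 - m - d\<close> away from \<open>-1\<close> and apart.\<close>
  have lowest: "(F * F * ?t (1 - 2 * d), of_int (m * (2 - m)) * (c * c)) \<in> \<kk>"
    if "m > \<bar>d\<bar> + 4" for m
  proof -
    let ?a = "m - d" and ?b = "2 - m - d"
    have t: "vanishes_below k (?t k)" for k
      by (simp add: vanishes_below_def lookup_single)
    have lead: "vanishes_below m (F * ?t ?a)" "Poly_Mapping.lookup (F * ?t ?a) m = c"
        "vanishes_below (2 - m) (F * ?t ?b)" "Poly_Mapping.lookup (F * ?t ?b) (2 - m) = c"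
      using vanishes_below_mult[OF Fd(1) t[of ?a]] lookup_mult_lowest[OF Fd(1) t[of ?a]]
        vanishes_below_mult[OF Fd(1) t[of ?b]] lookup_mult_lowest[OF Fd(1) t[of ?b]]
      by (simp_all add: c_def)
    have neq: "?a \<noteq> -1" "?b \<noteq> -1" "?a \<noteq> ?b"
      using that by auto
    have ba: "?b - ?a = 2 - m - m" by simp
    have "(of_int (2 - m - m) :: complex) \<noteq> 0"
      unfolding of_int_eq_0_iff using that by simp
    moreover have "snd (vir_bracket (F * ?t ?a, 0) (F * ?t ?b, 0)) =
        of_int (m * (2 - m) * (2 - m - m)) * (c * c)"
      using cocycle_lowest[OF lead(1,3)] lead(2,4) by simp
    ultimately have "snd (vir_bracket (F * ?t ?a, 0) (F * ?t ?b, 0)) / of_int (?b - ?a) =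
        of_int (m * (2 - m)) * (c * c)"
      unfolding ba of_int_mult by simp
    moreover have "?a + ?b - 1 = 1 - 2 * d" by simp
    ultimately show ?thesis
      using product_mem[OF neq] by simp
  qed
  have z: "vir_z \<in> \<kk>"
  proof -
    define m where "m = \<bar>d\<bar> + 5"
    define r :: complex where "r = of_int (m * (2 - m) - (m + 1) * (2 - (m + 1))) * (c * c)"
    have "m * (2 - m) - (m + 1) * (2 - (m + 1)) = 2 * m - 1"
      by (simp add: algebra_simps)
    moreover have "2 * m - 1 \<noteq> 0"
      by presburger
    ultimately have "r \<noteq> 0"
      unfolding r_def using Fd(2) by (metis mult_eq_0_iff of_int_eq_0_iff)
    have "(F * F * ?t (1 - 2 * d), of_int (m * (2 - m)) * (c * c)) -
        (F * F * ?t (1 - 2 * d), of_int ((m + 1) * (2 - (m + 1))) * (c * c)) \<in> \<kk>"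
      by (intro Vir.subspace_diff[OF K] lowest) (auto simp: m_def)
    then have "(0, r) \<in> \<kk>"
      by (simp add: r_def algebra_simps)
    from Vir.subspace_scale[OF K this, of "1 / r"] \<open>r \<noteq> 0\<close> show ?thesis
      by (simp add: vir_scale_def vir_z_def laurent_scale_conv_mult)
  qed
  have ideal: "vir_vf (F * F * g) \<in> \<kk>" for g
  proof (induction g rule: laurent_induct)
    case zero
    show ?case using Vir.subspace_0[OF K] by (simp add: vir_vf_def zero_prod_def)
  next
    case (add_single g k r)
    \<comment> \<open>Any distinct exponents other than \<open>-1\<close> with sum \<open>k + 1\<close> serve; here \<open>?a \<ge> 3\<close> and \<open>?b \<le> -2\<close>.\<close>
    let ?a = "\<bar>k\<bar> + 3" and ?b = "k - 2 - \<bar>k\<bar>"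
    have "?a \<noteq> -1" "?b \<noteq> -1" "?a \<noteq> ?b" by auto
    from product_mem[OF this] obtain s where s: "(F * F * ?t k, s) \<in> \<kk>"
      by auto
    have "vir_scale r ((F * F * ?t k, s) - vir_scale s vir_z) \<in> \<kk>"
      by (intro Vir.subspace_scale[OF K] Vir.subspace_diff[OF K] s z)
    also have "vir_scale r ((F * F * ?t k, s) - vir_scale s vir_z) =
        vir_vf (F * F * Poly_Mapping.single k r)"
      by (simp add: vir_scale_def vir_z_def vir_vf_def laurent_scale_conv_mult
          mult.left_commute[of "Poly_Mapping.single 0 _"] mult_single)
    finally have "vir_vf (F * F * g) + vir_vf (F * F * Poly_Mapping.single k r) \<in> \<kk>"
      by (intro Vir.subspace_add[OF K] add_single)
    then show ?case
      by (simp add: vir_vf_def distrib_left)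
  qed
  have "{vir_scale c vir_z + vir_vf (F * F * g) | c g. True} \<subseteq> \<kk>"
    by (auto intro!: Vir.subspace_add[OF K] Vir.subspace_scale[OF K] z ideal)
  with FF z show ?thesis by blast
qed

end
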